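(* Let $R$ be a noncommutative finite-dimensional division algebra over a field $F$ and let $p\in F[x]$ be a nonconstant polynomial. Then $R$ is generated as an $F$-algebra by the set $p[R,R]=\{p(ab)-p(ba)\mid a,b\in R\}$. *)

theory Defs
  imports "HOL-Computational_Algebra.Polynomial"
begin

definition is_algebra :: "('f::field \<Rightarrow> 'r::ring_1 \<Rightarrow> 'r) \<Rightarrow> bool" where
  "is_algebra scale \<longleftrightarrow> vector_space scale \<and>
     (\<forall>c x y. scale c (x * y) = scale c x * y \<and> scale c (x * y) = x * scale c y)"

definition fin_dim :: "('f::field \<Rightarrow> 'r::ring_1 \<Rightarrow> 'r) \<Rightarrow> bool" where
  "fin_dim scale \<longleftrightarrow> (\<exists>B. finite B \<and> module.span scale B = UNIV)"

definition poly_alg :: "('f::field \<Rightarrow> 'r::ring_1 \<Rightarrow> 'r) \<Rightarrow> 'f poly \<Rightarrow> 'r \<Rightarrow> 'r" where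
  "poly_alg scale p x = (\<Sum>i\<le>degree p. scale (coeff p i) (x ^ i))"

definition is_subalgebra :: "('f::field \<Rightarrow> 'r::ring_1 \<Rightarrow> 'r) \<Rightarrow> 'r set \<Rightarrow> bool" where
  "is_subalgebra scale A \<longleftrightarrow> 1 \<in> A \<and> (\<forall>x\<in>A. \<forall>y\<in>A. x + y \<in> A \<and> x * y \<in> A)
     \<and> (\<forall>c. \<forall>x\<in>A. scale c x \<in> A)"

definition alg_generated :: "('f::field \<Rightarrow> 'r::ring_1 \<Rightarrow> 'r) \<Rightarrow> 'r set \<Rightarrow> 'r set" where
  "alg_generated scale S = \<Inter>{A. is_subalgebra scale A \<and> S \<subseteq> A}"

end

theory Submission
  imports Defs "HOL-Computational_Algebra.Primes" "HOL-Library.FuncSet"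
begin

text \<open>
  Since \<open>b a = a\<^sup>-\<^sup>1 (a b) a\<close>, the set in question consists of the elements
  \<open>c - u c u\<^sup>-\<^sup>1\<close> with \<open>c\<close> a value of \<open>p\<close> and \<open>u \<noteq> 0\<close>. It is stable under conjugation, so the
  algebra it generates is a conjugation-invariant division subring, hence everything or central by
  Cartan-Brauer-Hua. In the central case all values of \<open>p\<close> are central. The field \<open>F\<close> is infinite
  by Wedderburn's little theorem, so replacing \<open>x\<close> by \<open>l x\<close> and comparing coefficients of powers of
  \<open>l\<close> makes \<open>x ^ n\<close> central for all \<open>x\<close>, where \<open>n = degree p\<close>. For the least such \<open>n\<close>, the same
  argument with \<open>(1 + l x) ^ n\<close> kills the binomial coefficients \<open>n choose i\<close>, \<open>0 < i < n\<close>, in \<open>R\<close>.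
  Then every \<open>ad a\<close> is nilpotent; if some \<open>ad a\<close> is nonzero, there is \<open>c\<close> with
  \<open>a c a\<^sup>-\<^sup>1 = 1 + c\<close>, so \<open>c ^ n = (1 + c) ^ n = 1 + c ^ n\<close>, which is absurd.

  For Wedderburn's theorem, a noncommutative finite division ring contains a commutative division
  ring \<open>K\<close> and an element \<open>y\<close> that normalises but does not centralise \<open>K\<close>. Surjectivity of the
  norm of \<open>K\<close> lets one scale \<open>y\<close> to an element \<open>x\<close> with \<open>x ^ r = 1\<close>, where \<open>r\<close> is the order of
  the action; then \<open>1 + x + \<dots> + x ^ (r - 1) = 0\<close> contradicts the independence of
  the powers of \<open>x\<close> over \<open>K\<close>.
\<close>

subsection \<open>Binomial expansions\<close>

text \<open>Induction by Pascal's rule. Commuting additive maps cover both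
  \<open>(1 + x) ^ n\<close> and the powers of \<open>ad a\<close>, since left and right
  multiplications commute even when the elements do not.\<close>

lemma binomial_commuting_additive:
  fixes f g :: "'a::ring_1 \<Rightarrow> 'a"
  assumes f: "\<And>x y. f (x + y) = f x + f y" and g: "\<And>x y. g (x + y) = g x + g y"
    and fg: "\<And>x. f (g x) = g (f x)"
  shows "((\<lambda>x. f x + g x) ^^ n) v = (\<Sum>i\<le>n. of_nat (n choose i) * (f ^^ i) ((g ^^ (n - i)) v))"
proof (induction n)
  case 0
  show ?case by simp
next
  case (Suc n)
  have f0: "f 0 = 0" and g0: "g 0 = 0"
    using f[of 0 0] g[of 0 0] by simp_all
  have fs: "f (sum h A) = (\<Sum>i\<in>A. f (h i))" and gs: "g (sum h A) = (\<Sum>i\<in>A. g (h i))"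
    for h and A :: "nat set"
    by (induction A rule: infinite_finite_induct) (simp_all add: f g f0 g0)
  have fn: "f (of_nat k * x) = of_nat k * f x" and gn: "g (of_nat k * x) = of_nat k * g x" for k x
    by (induction k) (simp_all add: f g f0 g0 distrib_right)
  have gf: "g ((f ^^ i) x) = (f ^^ i) (g x)" for i x
    by (induction i) (simp_all add: fg[symmetric])
  define t where "t i = (f ^^ i) ((g ^^ (Suc n - i)) v)" for i
  have F: "f (\<Sum>i\<le>n. of_nat (n choose i) * (f ^^ i) ((g ^^ (n - i)) v))
      = (\<Sum>i\<le>n. of_nat (n choose i) * t (Suc i))"
    by (simp add: fs fn t_def)
  have G: "g (\<Sum>i\<le>n. of_nat (n choose i) * (f ^^ i) ((g ^^ (n - i)) v))
      = (\<Sum>i\<le>n. of_nat (n choose i) * t i)"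
    by (simp add: gs gn gf t_def Suc_diff_le)
  have "(\<Sum>i\<le>Suc n. of_nat (Suc n choose i) * t i)
      = t 0 + (\<Sum>i\<le>n. of_nat (Suc n choose Suc i) * t (Suc i))"
    by (subst sum.atMost_Suc_shift) simp
  also have "\<dots> = (\<Sum>i\<le>n. of_nat (n choose i) * t (Suc i))
      + (t 0 + (\<Sum>i\<le>n. of_nat (n choose Suc i) * t (Suc i)))"
    by (simp add: distrib_right sum.distrib)
  also have "t 0 + (\<Sum>i\<le>n. of_nat (n choose Suc i) * t (Suc i))
      = (\<Sum>i\<le>Suc n. of_nat (n choose i) * t i)"
    by (subst sum.atMost_Suc_shift) simp
  also have "\<dots> = (\<Sum>i\<le>n. of_nat (n choose i) * t i)"
    by (simp add: binomial_eq_0)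
  finally show ?case
    using Suc F G by (simp add: t_def)
qed

lemma binomial_one_plus:
  fixes x :: "'a::ring_1"
  shows "(1 + x) ^ n = (\<Sum>i\<le>n. of_nat (n choose i) * x ^ i)"
proof -
  have *: "((*) c ^^ k) v = c ^ k * v" for c v :: 'a and k
    by (induction k) (simp_all add: mult.assoc)
  have "(\<lambda>v. x * v + v) = (*) (1 + x)"
    by (auto simp: algebra_simps)
  then show ?thesis
    using binomial_commuting_additive[of "(*) x" "\<lambda>v. v" n 1]
    by (simp add: * algebra_simps flip: id_def)
qed

lemma one_plus_power_eq:
  fixes c :: "'a::ring_1"
  assumes "\<And>i. 0 < i \<Longrightarrow> i < n \<Longrightarrow> of_nat (n choose i) = (0::'a)" and "0 < n"
  shows "(1 + c) ^ n = 1 + c ^ n"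
proof -
  obtain m where m: "n = Suc m"
    using assms(2) gr0_implies_Suc by blast
  have "(\<Sum>i\<le>n. of_nat (n choose i) * c ^ i)
      = 1 + (\<Sum>i\<in>{0<..<n}. of_nat (n choose i) * c ^ i) + c ^ n"
  proof -
    have "{..n} = insert 0 (insert n {0<..<n})"
      using assms(2) by auto
    then show ?thesis
      using assms(2) by (simp add: add_ac)
  qed
  also have "(\<Sum>i\<in>{0<..<n}. of_nat (n choose i) * c ^ i) = 0"
    by (rule sum.neutral) (use assms(1) in auto)
  finally show ?thesis
    by (simp add: binomial_one_plus)
qed

lemma geometric_sum_mult:
  fixes q :: "'a::ring_1"
  shows "(\<Sum>i<n. q ^ i) * (q - 1) = q ^ n - 1"
  by (induction n) (simp_all add: algebra_simps power_commutes)

lemma ad_funpow: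
  fixes a :: "'a::ring_1"
  shows "((\<lambda>x. a * x - x * a) ^^ n) v
    = (\<Sum>i\<le>n. of_nat (n choose i) * (a ^ i * (v * (- a) ^ (n - i))))"
proof -
  have 1: "((*) a ^^ k) v = a ^ k * v" for v :: 'a and k
    by (induction k) (simp_all add: mult.assoc)
  have 2: "((\<lambda>x. x * - a) ^^ k) v = v * (- a) ^ k" for v :: 'a and k
    by (induction k) (simp_all add: mult.assoc power_Suc2 del: power_Suc mult_minus_right mult_minus_left)
  show ?thesis
    using binomial_commuting_additive[of "(*) a" "\<lambda>x. x * - a" n v]
    unfolding 1 2 by (simp add: algebra_simps)
qed

lemma prime_of_nat_eq_0:
  assumes "of_nat n = (0::'a::division_ring)" and "0 < n"
  shows "\<exists>p. prime p \<and> p dvd n \<and> of_nat p = (0::'a)"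
  using assms
proof (induction n rule: less_induct)
  case (less n)
  then have "n \<noteq> 1"
    by auto
  then obtain p where p: "prime p" "p dvd n"
    using prime_factor_nat by blast
  then obtain m where m: "n = p * m"
    by (auto elim: dvdE)
  show ?case
  proof (cases "of_nat p = (0::'a)")
    case False
    then have "of_nat m = (0::'a)"
      using less.prems m by simp
    moreover have "m < n" "0 < m"
      using m less.prems prime_gt_1_nat[OF p(1)] by auto
    ultimately obtain q where "prime q" "q dvd m" "of_nat q = (0::'a)"
      using less.IH by blast
    then show ?thesis
      using m by auto
  qed (use p in blast)
qed

text \<open>In characteristic \<open>p\<close> the binomial expansion collapses to
  \<open>(b - 1) ^ p = b ^ p - 1\<close>.\<close>

lemma power_prime_char_eq_1:
  fixes b :: "'a::division_ring"
  assumes "prime p" and "of_nat p = (0::'a)" and "b ^ p = 1"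
  shows "b = 1"
proof -
  have "of_nat (p choose i) = (0::'a)" if "0 < i" "i < p" for i
  proof -
    have "p dvd (p choose i)"
      using that assms(1) by (intro dvd_choose_prime) auto
    then show ?thesis
      using assms(2) by (auto elim!: dvdE)
  qed
  then have "(1 + (b - 1)) ^ p = 1 + (b - 1) ^ p"
    using assms(1) prime_gt_0_nat by (intro one_plus_power_eq) auto
  then show ?thesis
    using assms(3) by simp
qed

lemma ex_power_eq_1:
  fixes a :: "'a::division_ring"
  assumes "finite (UNIV :: 'a set)" and "a \<noteq> 0"
  shows "\<exists>n>0. a ^ n = 1"
proof -
  have "\<not> inj (\<lambda>n::nat. a ^ n)"
    using assms(1) finite_imageD[of "\<lambda>n::nat. a ^ n" UNIV] finite_subset[OF subset_UNIV]
    by blast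
  then obtain i j :: nat where "i \<noteq> j" "a ^ i = a ^ j"
    by (auto simp: inj_def)
  then obtain i j :: nat where ij: "i < j" "a ^ i = a ^ j"
    by (metis linorder_neqE_nat)
  then have "a ^ i * a ^ (j - i) = a ^ i * 1"
    using power_add[of a i "j - i"] by simp
  then show ?thesis
    using ij assms(2) by (intro exI[of _ "j - i"]) simp
qed

subsection \<open>Finite division rings\<close>

text \<open>The \<open>w j\<close> in the proof are the components of \<open>v\<close> in the eigenspaces of right
  multiplication by \<open>a\<close> (a discrete Fourier transform).\<close>

lemma ex_conj_eq_power:
  fixes a v :: "'a::division_ring"
  assumes fin: "finite (UNIV :: 'a set)" and av: "a * v \<noteq> v * a"
  shows "\<exists>y j. y \<noteq> 0 \<and> y * a = a ^ j * y \<and> a ^ j \<noteq> a"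
proof (rule ccontr)
  assume contra: "\<not> ?thesis"
  have a0: "a \<noteq> 0"
    using av by auto
  define n where "n = (LEAST n. 0 < n \<and> a ^ n = 1)"
  have n: "0 < n \<and> a ^ n = 1"
    unfolding n_def using ex_power_eq_1[OF fin a0] LeastI_ex[of "\<lambda>n. 0 < n \<and> a ^ n = 1"] by blast
  have least: "a ^ m \<noteq> 1" if "0 < m" "m < n" for m
    using that not_less_Least[of m "\<lambda>n. 0 < n \<and> a ^ n = 1"] unfolding n_def by blast
  define u where "u = inverse a"
  have au: "a * u = 1" "u * a = 1"
    using a0 by (auto simp: u_def)
  have aun: "a ^ m * u ^ m = 1" for m
    using a0 by (simp add: u_def power_inverse)
  have un: "u ^ n = 1"
    using n by (simp add: u_def power_inverse)
  define w where "w j = (\<Sum>m<n. (u ^ j) ^ m * v * a ^ m)" for j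
  \<comment> \<open>Shift the summation index by one: the sum runs over a full period, because
    \<open>u ^ n = 1\<close> and \<open>a ^ n = 1\<close>.\<close>
  have wa: "w j * a = a ^ j * w j" for j
  proof -
    have "a ^ j * w j = a ^ j * (\<Sum>m<n. (u ^ j) ^ Suc m * v * a ^ Suc m)"
    proof -
      have "(u ^ j) ^ n = 1"
        by (metis un power_one power_mult mult.commute)
      then have "(\<Sum>m<Suc n. (u ^ j) ^ m * v * a ^ m) = w j + v"
        using n by (simp add: w_def)
      moreover have "(\<Sum>m<Suc n. (u ^ j) ^ m * v * a ^ m)
          = v + (\<Sum>m<n. (u ^ j) ^ Suc m * v * a ^ Suc m)"
        by (subst sum.lessThan_Suc_shift) simp
      ultimately show ?thesis
        by simp
    qed
    also have "\<dots> = (\<Sum>m<n. (a ^ j * u ^ j) * ((u ^ j) ^ m * v * (a ^ m * a)))"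
      by (simp add: sum_distrib_left mult.assoc power_commutes)
    also have "\<dots> = w j * a"
      by (simp add: aun w_def sum_distrib_right mult.assoc)
    finally show ?thesis ..
  qed
  \<comment> \<open>A nonzero \<open>w j\<close> would serve as \<open>y\<close>, so the negated
    goal forces \<open>a ^ j = a\<close>.\<close>
  have comm: "w j * a = a * w j" for j
    using contra wa[of j] by (cases "w j = 0") auto
  \<comment> \<open>Swapping the sums leaves geometric sums in the roots of unity
    \<open>u ^ m\<close>, which vanish for \<open>0 < m < n\<close>.\<close>
  have "(\<Sum>j<n. w j) = (\<Sum>m<n. (\<Sum>j<n. (u ^ m) ^ j) * v * a ^ m)"
    unfolding w_def sum_distrib_right
    by (subst sum.swap) (simp add: mult.commute flip: power_mult)
  also have "\<dots> = (\<Sum>m<n. if m = 0 then of_nat n * v else 0)"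
  proof (rule sum.cong[OF refl])
    fix m assume m: "m \<in> {..<n}"
    show "(\<Sum>j<n. (u ^ m) ^ j) * v * a ^ m = (if m = 0 then of_nat n * v else 0)"
    proof (cases "m = 0")
      case False
      then have "u ^ m \<noteq> 1"
        using least[of m] aun[of m] m by auto
      moreover have "(\<Sum>j<n. (u ^ m) ^ j) * (u ^ m - 1) = 0"
        unfolding geometric_sum_mult
        by (metis un power_one power_mult mult.commute diff_self)
      ultimately show ?thesis
        using False by simp
    qed simp
  qed
  also have "\<dots> = of_nat n * v"
    using n by (simp add: sum.delta)
  finally have sum: "(\<Sum>j<n. w j) = of_nat n * v" .
  \<comment> \<open>Otherwise some prime \<open>p\<close> dividing \<open>n\<close> is the
    characteristic, and \<open>a ^ (n div p)\<close> would be a nontrivial \<open>p\<close>-th root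
    of unity.\<close>
  have "of_nat n \<noteq> (0::'a)"
  proof
    assume "of_nat n = (0::'a)"
    then obtain p where p: "prime p" "p dvd n" "of_nat p = (0::'a)"
      using prime_of_nat_eq_0 n by blast
    then obtain m where m: "n = p * m"
      by (auto elim: dvdE)
    then have "(a ^ m) ^ p = 1"
      using n by (metis power_mult mult.commute)
    then have "a ^ m = 1"
      using p power_prime_char_eq_1 by blast
    then show False
      using least[of m] m n prime_gt_1_nat[OF p(1)] by auto
  qed
  moreover have "of_nat n * (v * a) = of_nat n * (a * v)"
  proof -
    have "(\<Sum>j<n. w j) * a = a * (\<Sum>j<n. w j)"
      by (simp add: sum_distrib_left sum_distrib_right comm)
    then show ?thesis
      unfolding sum by (metis mult.assoc mult_of_nat_commute)
  qed
  ultimately show False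
    using av by simp
qed

text \<open>Dedekind's argument: subtracting \<open>f n g\<close> times the relation at
  \<open>c\<close> from the relation at \<open>c * g\<close> removes the last term. The coefficients
  \<open>k i\<close> stand on the right, so they may lie outside \<open>K\<close>.\<close>

lemma dedekind_independence:
  fixes f :: "nat \<Rightarrow> 'a::division_ring \<Rightarrow> 'a"
  assumes one: "1 \<in> K" and times: "\<And>c g. c \<in> K \<Longrightarrow> g \<in> K \<Longrightarrow> c * g \<in> K"
    and comm: "\<And>c g. c \<in> K \<Longrightarrow> g \<in> K \<Longrightarrow> c * g = g * c"
    and f_in: "\<And>i c. c \<in> K \<Longrightarrow> f i c \<in> K"
    and f_one: "\<And>i. f i 1 = 1"
    and f_mult: "\<And>i c g. c \<in> K \<Longrightarrow> g \<in> K \<Longrightarrow> f i (c * g) = f i c * f i g"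
    and f_distinct: "\<And>i j. i < j \<Longrightarrow> j < n \<Longrightarrow> \<exists>g\<in>K. f i g \<noteq> f j g"
    and zero: "\<And>c. c \<in> K \<Longrightarrow> (\<Sum>i<n. f i c * k i) = 0"
  shows "\<forall>i<n. k i = 0"
  using f_distinct zero
proof (induction n arbitrary: k)
  case (Suc n)
  have "(\<Sum>i<n. f i c * ((f i g - f n g) * k i)) = 0" if "c \<in> K" "g \<in> K" for c g
  proof -
    have eq: "f i (c * g) * k i - f n g * (f i c * k i) = f i c * ((f i g - f n g) * k i)" for i
    proof -
      have "f n g * f i c = f i c * f n g"
        using comm f_in that by blast
      then have "f n g * (f i c * k i) = f i c * (f n g * k i)"
        by (metis mult.assoc)
      then show ?thesis
        using f_mult[OF that, of i] by (simp add: algebra_simps)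
    qed
    have "(\<Sum>i<Suc n. f i (c * g) * k i) - f n g * (\<Sum>i<Suc n. f i c * k i) = 0"
      using Suc.prems(2)[of c] Suc.prems(2)[of "c * g"] times that by simp
    also have "(\<Sum>i<Suc n. f i (c * g) * k i) - f n g * (\<Sum>i<Suc n. f i c * k i)
        = (\<Sum>i<Suc n. f i c * ((f i g - f n g) * k i))"
      by (simp only: sum_distrib_left sum_subtractf[symmetric] eq)
    finally show ?thesis
      by simp
  qed
  then have "\<forall>i<n. (f i g - f n g) * k i = 0" if "g \<in> K" for g
    using that Suc.prems(1) by (intro Suc.IH) auto
  then have k: "\<forall>i<n. k i = 0"
    using Suc.prems(1)[of _ n] by fastforce
  then have "k n = 0"
    using Suc.prems(2)[OF one] by (simp add: f_one)
  with k show ?case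
    by (auto simp: less_Suc_eq)
qed simp

text \<open>Conjugation by \<open>y\<close> acts on the finite field \<open>K\<close>. Its
  \<open>r\<close>-th power acts trivially because \<open>y ^ r\<close> lies in the commutative
  \<open>K\<close>, while \<open>a\<close> witnesses that no smaller positive power does. The aim is
  to refute these assumptions.\<close>

locale cyclic_algebra =
  fixes K :: "'a::division_ring set" and y a :: 'a and r :: nat
  assumes fin: "finite K"
    and zero: "0 \<in> K" and one: "1 \<in> K"
    and plus: "\<And>c g. c \<in> K \<Longrightarrow> g \<in> K \<Longrightarrow> c + g \<in> K"
    and times: "\<And>c g. c \<in> K \<Longrightarrow> g \<in> K \<Longrightarrow> c * g \<in> K"
    and inv: "\<And>c. c \<in> K \<Longrightarrow> inverse c \<in> K"
    and comm: "\<And>c g. c \<in> K \<Longrightarrow> g \<in> K \<Longrightarrow> c * g = g * c"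
    and y0: "y \<noteq> 0"
    and conj: "\<And>c. c \<in> K \<Longrightarrow> y * c * inverse y \<in> K"
    and yr: "y ^ r \<in> K" and r: "1 < r"
    and a: "a \<in> K" and ya: "\<And>i. 0 < i \<Longrightarrow> i < r \<Longrightarrow> y ^ i * a \<noteq> a * y ^ i"
begin

definition s :: "nat \<Rightarrow> 'a \<Rightarrow> 'a" where
  "s i g = y ^ i * g * inverse y ^ i"

lemma iyy: "inverse y ^ i * y ^ i = 1" "y ^ i * inverse y ^ i = 1"
  using y0 by (simp_all add: power_inverse)

lemma s_0: "s 0 g = g"
  by (simp add: s_def)

lemma s_Suc: "s (Suc i) g = y * s i g * inverse y"
  by (simp add: s_def mult.assoc power_commutes)

lemma s_in: "g \<in> K \<Longrightarrow> s i g \<in> K"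
  by (induction i) (simp_all add: s_0 s_Suc conj)

lemma s_one: "s i 1 = 1"
  by (simp add: s_def iyy)

lemma s_mult: "s i (c * g) = s i c * s i g"
proof -
  have "s i c * s i g = y ^ i * c * (inverse y ^ i * y ^ i) * g * inverse y ^ i"
    by (simp add: s_def mult.assoc)
  also have "\<dots> = s i (c * g)"
    by (simp only: iyy s_def mult.assoc mult_1_right mult_1_left)
  finally show ?thesis ..
qed

lemma s_distinct:
  assumes "i < j" "j < r"
  shows "s i a \<noteq> s j a"
proof
  assume eq: "s i a = s j a"
  have "inverse y ^ i * s i a * y ^ i = inverse y ^ i * y ^ i * a * (inverse y ^ i * y ^ i)"
    by (simp add: s_def mult.assoc)
  then have 1: "inverse y ^ i * s i a * y ^ i = a"
    by (simp add: iyy)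
  have "y ^ j = y ^ i * y ^ (j - i)" "inverse y ^ j = inverse y ^ (j - i) * inverse y ^ i"
    using assms by (simp_all flip: power_add)
  then have "inverse y ^ i * s j a * y ^ i
      = inverse y ^ i * y ^ i * (y ^ (j - i) * a * inverse y ^ (j - i)) * (inverse y ^ i * y ^ i)"
    by (simp add: s_def mult.assoc)
  then have 2: "inverse y ^ i * s j a * y ^ i = y ^ (j - i) * a * inverse y ^ (j - i)"
    by (simp add: iyy)
  have "a * y ^ (j - i) = y ^ (j - i) * a * (inverse y ^ (j - i) * y ^ (j - i))"
    using 1 2 eq by (metis mult.assoc)
  then show False
    using ya[of "j - i"] assms less_imp_diff_less[of j r i] by (simp add: iyy)
qed

text \<open>Dedekind's lemma for the characters \<open>s i\<close> of \<open>K\<close>. The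
  coefficient at 0 suffices, since it equals 1 in both applications.\<close>

lemma independent:
  assumes "\<And>c. c \<in> K \<Longrightarrow> (\<Sum>i<r. s i c * k i) = 0"
  shows "k 0 = 0"
proof -
  have "\<forall>i<r. k i = 0"
  proof (rule dedekind_independence[of K s])
    show "\<exists>g\<in>K. s i g \<noteq> s j g" if "i < j" "j < r" for i j
      using s_distinct[OF that] a by blast
  qed (use one times comm s_in s_one s_mult assms in auto)
  then show ?thesis
    using r by simp
qed

text \<open>Since \<open>c\<close> commutes with \<open>K\<close>, moving \<open>g\<close> past
  \<open>c * y\<close> has the same effect as moving it past \<open>y\<close>.\<close>

lemma act:
  assumes "c \<in> K" "g \<in> K"
  shows "(c * y) ^ i * g = s i g * (c * y) ^ i"
proof (induction i)
  case (Suc i)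
  have "(c * y) ^ Suc i * g = c * (y * s i g * (inverse y * y)) * (c * y) ^ i"
    using Suc y0 by (simp add: mult.assoc)
  also have "\<dots> = c * s (Suc i) g * y * (c * y) ^ i"
    by (simp add: s_Suc mult.assoc)
  also have "c * s (Suc i) g = s (Suc i) g * c"
    using assms s_in comm by blast
  finally show ?case
    by (simp add: mult.assoc)
qed (simp add: s_0)

text \<open>The outermost factors are \<open>c * y\<close> and \<open>inverse y * inverse d\<close>,
  so each step conjugates the previous quotient by \<open>y\<close> and multiplies it by elements of
  \<open>K\<close>.\<close>

lemma quotient_in:
  assumes "c \<in> K" "d \<in> K" "d \<noteq> 0"
  shows "(c * y) ^ i * inverse (d * y) ^ i \<in> K"
proof (induction i)
  case (Suc i)
  have "(c * y) ^ Suc i * inverse (d * y) ^ Suc i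
      = c * (y * ((c * y) ^ i * inverse (d * y) ^ i) * inverse y) * inverse d"
    by (simp only: power_Suc[of "c * y"] power_Suc2[of "inverse y * inverse d"] mult.assoc
        nonzero_inverse_mult_distrib[OF assms(3) y0])
  then show ?case
    using Suc assms conj times inv by simp
qed (simp add: one)

text \<open>The power is \<open>y ^ r\<close> times the norm of \<open>c\<close>, that is, the
  product of the conjugates \<open>s i c\<close> with \<open>i < r\<close>.\<close>

lemma power_in:
  assumes "c \<in> K"
  shows "(c * y) ^ r \<in> K"
proof -
  have "(c * y) ^ r = (c * y) ^ r * inverse (1 * y) ^ r * y ^ r"
    by (simp add: mult.assoc iyy)
  then show ?thesis
    using times[OF quotient_in[OF assms one, of r] yr] by simp
qed

text \<open>The power commutes with \<open>c * y\<close> and, lying in \<open>K\<close>, also with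
  \<open>c\<close>; then \<open>c\<close> cancels.\<close>

lemma power_commutes_y:
  assumes "c \<in> K" "c \<noteq> 0"
  shows "(c * y) ^ r * y = y * (c * y) ^ r"
proof -
  have "c * ((c * y) ^ r * y) = (c * y) ^ r * (c * y)"
    using comm[OF assms(1) power_in[OF assms(1)]] by (metis mult.assoc)
  also have "\<dots> = c * (y * (c * y) ^ r)"
    by (simp only: power_commutes mult.assoc)
  finally show ?thesis
    using assms(2) by simp
qed

lemma sum_in: "(\<And>i. i \<in> A \<Longrightarrow> h i \<in> K) \<Longrightarrow> sum h A \<in> K"
  by (induction A rule: infinite_finite_induct) (simp_all add: zero plus)

text \<open>Hilbert's Theorem 90, with the cocycle written as a quotient of two elements of \<open>K * y\<close>.\<close>

lemma conjugate_of_power_eq: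
  assumes c: "c \<in> K" "c \<noteq> 0" and d: "d \<in> K" "d \<noteq> 0" and eq: "(c * y) ^ r = (d * y) ^ r"
  shows "\<exists>b\<in>K - {0}. c * y * b = b * (d * y)"
proof -
  define x w where "x = c * y" and "w = inverse (d * y)"
  have dw: "d * y * w = 1" "w * (d * y) = 1" "(d * y) ^ i * w ^ i = 1" for i
    using d y0 by (auto simp: w_def power_inverse)
  \<comment> \<open>A resolvent: \<open>x ^ r * e * w ^ r = e\<close> for \<open>e\<close> in
    \<open>K\<close>, so left multiplication by \<open>x\<close> and right multiplication by
    \<open>w\<close> permute the terms cyclically and fix \<open>b e\<close>. Some
    \<open>b e\<close> is nonzero by independence, the coefficient of \<open>s 0\<close> being
    1.\<close>
  define b where "b e = (\<Sum>i<r. x ^ i * e * w ^ i)" for e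
  have b: "b e = (\<Sum>i<r. s i e * (x ^ i * w ^ i))" if "e \<in> K" for e
    using act[OF c(1) that] by (simp add: b_def x_def mult.assoc flip: mult.assoc)
  have b_in: "b e \<in> K" if "e \<in> K" for e
    unfolding b[OF that] x_def w_def
    using quotient_in[OF c(1) d] s_in[OF that] times by (intro sum_in) blast
  obtain e where e: "e \<in> K" "b e \<noteq> 0"
  proof (rule ccontr)
    assume "\<not> thesis"
    then have "b e = 0" if "e \<in> K" for e
      using \<open>\<And>e. \<lbrakk>e \<in> K; b e \<noteq> 0\<rbrakk> \<Longrightarrow> thesis\<close> that by blast
    then have "(\<Sum>i<r. s i e * (x ^ i * w ^ i)) = 0" if "e \<in> K" for e
      using b[OF that] that by simp
    then show False
      using independent[of "\<lambda>i. x ^ i * w ^ i"] by simp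
  qed
  have "x * b e * w = (\<Sum>i<r. x ^ Suc i * e * w ^ Suc i)"
    by (simp add: b_def sum_distrib_left sum_distrib_right mult.assoc power_commutes)
  also have "\<dots> = b e"
  proof -
    have "x ^ r * e * w ^ r = e * ((d * y) ^ r * w ^ r)"
      using comm[OF power_in[OF c(1)] e(1)] eq by (simp add: x_def mult.assoc)
    then have "(\<Sum>i<Suc r. x ^ i * e * w ^ i) = b e + e"
      by (simp add: b_def dw)
    moreover have "(\<Sum>i<Suc r. x ^ i * e * w ^ i) = e + (\<Sum>i<r. x ^ Suc i * e * w ^ Suc i)"
      by (subst sum.lessThan_Suc_shift) simp
    ultimately show ?thesis
      by simp
  qed
  finally have "x * b e * (w * (d * y)) = b e * (d * y)"
    by (metis mult.assoc)
  then show ?thesis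
    using e b_in by (intro bexI[of _ "b e"]) (auto simp: dw x_def)
qed

text \<open>The unit group of the subfield of \<open>K\<close> fixed by conjugation with
  \<open>y\<close>.\<close>

definition L :: "'a set" where
  "L = {l \<in> K - {0}. l * y = y * l}"

text \<open>Fix \<open>d\<close> in the fiber. Every \<open>b c * l\<close> conjugates
  \<open>d * y\<close> to \<open>c * y\<close>, so the product determines \<open>c\<close> and then
  \<open>l\<close>; thus the pairs inject into the nonzero elements of \<open>K\<close>.\<close>

lemma fiber_card:
  "card {c \<in> K - {0}. (c * y) ^ r = t} * card L \<le> card (K - {0})"
proof (cases "{c \<in> K - {0}. (c * y) ^ r = t} = {}")
  case False
  then obtain d where d: "d \<in> K" "d \<noteq> 0" "(d * y) ^ r = t"
    by blast
  let ?F = "{c \<in> K - {0}. (c * y) ^ r = t}"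
  have "\<exists>b. b \<in> K - {0} \<and> c * y * b = b * (d * y)" if "c \<in> ?F" for c
    using conjugate_of_power_eq[of c d] d that by auto
  then obtain b where b: "\<And>c. c \<in> ?F \<Longrightarrow> b c \<in> K - {0} \<and> c * y * b c = b c * (d * y)"
    by metis
  have inj: "inj_on (\<lambda>(c, l). b c * l) (?F \<times> L)"
  proof (rule inj_onI)
    fix p q
    assume "p \<in> ?F \<times> L" "q \<in> ?F \<times> L" "(\<lambda>(c, l). b c * l) p = (\<lambda>(c, l). b c * l) q"
    then obtain c l c' l' where pq: "p = (c, l)" "q = (c', l')"
      and c: "c \<in> ?F" and c': "c' \<in> ?F" and l: "l \<in> L" and l': "l' \<in> L"
      and eq: "b c * l = b c' * l'"
      by (cases p, cases q) auto
    have ld: "m * (d * y) = d * y * m" if "m \<in> L" for m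
    proof -
      have "m * d = d * m" "m * y = y * m"
        using that comm[of m d] d by (auto simp: L_def)
      then show ?thesis
        by (metis mult.assoc)
    qed
    have bl: "c * y * (b c * l) = b c * l * (d * y)" if "c \<in> ?F" "l \<in> L" for c l
    proof -
      have "c * y * (b c * l) = b c * (d * y * l)"
        using b[OF that(1)] by (metis mult.assoc)
      also have "d * y * l = l * (d * y)"
        by (rule ld[OF that(2), symmetric])
      finally show ?thesis
        by (simp only: mult.assoc)
    qed
    have cb: "c * y * (b c * l) = b c * l * (d * y)"
      using c l by (rule bl)
    have cb': "c' * y * (b c' * l') = b c' * l' * (d * y)"
      using c' l' by (rule bl)
    have nz: "b c' * l' \<noteq> 0"
      using b[OF c'] l' by (simp add: L_def)
    have "c * y * (b c' * l') = c' * y * (b c' * l')"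
      using cb cb' eq by simp
    then have cc: "c = c'"
      using nz y0 by simp
    then show "p = q"
      using eq b[OF c] pq by simp
  qed
  have "card (?F \<times> L) \<le> card (K - {0})"
  proof (rule card_inj_on_le[OF inj])
    show "(\<lambda>(c, l). b c * l) ` (?F \<times> L) \<subseteq> K - {0}"
      using b times by (auto simp: L_def)
  qed (use fin in simp)
  then show ?thesis
    by (simp add: card_cartesian_product)
next
  case True
  then show ?thesis
    by (simp only: card.empty)
qed

text \<open>Surjectivity of the norm: the fibers of \<open>c \<mapsto> (c * y) ^ r\<close> are too small for it to miss a
  point of \<open>L\<close>.\<close>

lemma ex_power_eq_one: "\<exists>c\<in>K - {0}. (c * y) ^ r = 1"
proof -
  let ?N = "\<lambda>c. (c * y) ^ r"
  have sub: "?N ` (K - {0}) \<subseteq> L"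
    using power_in power_commutes_y y0 by (auto simp: L_def)
  have finL: "finite L"
    using fin by (simp add: L_def)
  have "card (K - {0}) = (\<Sum>t\<in>?N ` (K - {0}). card {c \<in> K - {0}. ?N c = t})"
    using sum.image_gen[of "K - {0}" "\<lambda>_. 1::nat" ?N] fin by simp
  then have "card (K - {0}) * card L
      = (\<Sum>t\<in>?N ` (K - {0}). card {c \<in> K - {0}. ?N c = t} * card L)"
    by (simp add: sum_distrib_right)
  also have "\<dots> \<le> (\<Sum>t\<in>?N ` (K - {0}). card (K - {0}))"
    by (intro sum_mono fiber_card)
  finally have "card (K - {0}) * card L \<le> card (K - {0}) * card (?N ` (K - {0}))"
    by (simp add: mult.commute)
  moreover have "0 < card (K - {0})"
    using one fin by (auto simp: card_gt_0_iff)
  ultimately have "card L \<le> card (?N ` (K - {0}))"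
    by simp
  then have "?N ` (K - {0}) = L"
    using card_seteq[OF finL sub] by simp
  moreover have "1 \<in> L"
    using one by (simp add: L_def)
  ultimately show ?thesis
    by (metis (no_types, lifting) imageE)
qed

lemma contradiction: False
proof -
  obtain c where c: "c \<in> K" "c \<noteq> 0" "(c * y) ^ r = 1"
    using ex_power_eq_one by blast
  have "c * y \<noteq> 1"
  proof
    assume "c * y = 1"
    then have "a = s 1 a"
      using act[OF c(1) a, of 1] by simp
    then show False
      using s_distinct[of 0 1] r by (simp add: s_0)
  qed
  moreover have "(\<Sum>i<r. (c * y) ^ i) * (c * y - 1) = 0"
    by (simp add: geometric_sum_mult c)
  ultimately have "(\<Sum>i<r. (c * y) ^ i) = 0"
    by simp
  \<comment> \<open>Multiply the vanishing sum by \<open>g\<close> on the right and move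
    \<open>g\<close> to the left of each power.\<close>
  then have "(\<Sum>i<r. s i g * (c * y) ^ i) = 0" if "g \<in> K" for g
    using act[OF c(1) that, symmetric] by (simp flip: sum_distrib_right)
  then show False
    using independent[of "\<lambda>i. (c * y) ^ i"] by simp
qed

end

section \<open>Centralizers and Wedderburn's little theorem\<close>

definition centralizer :: "'a::times set \<Rightarrow> 'a set" where
  "centralizer S = {x. \<forall>u\<in>S. x * u = u * x}"

lemma centralizer_inverse:
  fixes x :: "'a::division_ring"
  assumes "x \<in> centralizer S"
  shows "inverse x \<in> centralizer S"
proof (cases "x = 0")
  case False
  have "inverse x * u = u * inverse x" if "u \<in> S" for u
  proof -
    have "inverse x * (x * u) * inverse x = inverse x * (u * x) * inverse x"
      using assms that by (simp add: centralizer_def)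
    then have "(inverse x * x) * u * inverse x = inverse x * u * (x * inverse x)"
      by (simp only: mult.assoc)
    then show ?thesis
      using False by simp
  qed
  then show ?thesis
    by (simp add: centralizer_def)
qed (use assms in simp)

text \<open>The sets \<open>S\<close> and \<open>T\<close> are kept apart because conjugation by
  \<open>y\<close> replaces \<open>a\<close> by \<open>a ^ j\<close>.\<close>

lemma centralizer_conj:
  fixes x y :: "'a::division_ring"
  assumes "y \<noteq> 0" and "x \<in> centralizer S" and "\<And>u. u \<in> T \<Longrightarrow> inverse y * u * y \<in> S"
  shows "y * x * inverse y \<in> centralizer T"
proof -
  have "y * x * inverse y * u = u * (y * x * inverse y)" if "u \<in> T" for u
  proof -
    have yy: "y * inverse y = 1"
      using assms(1) by simp
    have "y * (x * (inverse y * u * y)) * inverse y = y * ((inverse y * u * y) * x) * inverse y"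
      using assms(2) assms(3)[OF that] by (simp add: centralizer_def)
    then have "y * x * inverse y * u * (y * inverse y) = (y * inverse y) * u * (y * x * inverse y)"
      by (simp only: mult.assoc)
    then show ?thesis
      by (simp add: yy)
  qed
  then show ?thesis
    by (simp add: centralizer_def)
qed

theorem wedderburn_little:
  fixes a b :: "'a::division_ring"
  assumes fin: "finite (UNIV :: 'a set)"
  shows "a * b = b * a"
proof (rule ccontr)
  assume "a * b \<noteq> b * a"
  then obtain y j where y: "y \<noteq> 0" "y * a = a ^ j * y" "a ^ j \<noteq> a"
    using ex_conj_eq_power[OF fin] by blast
  define r where "r = (LEAST r. 0 < r \<and> y ^ r * a = a * y ^ r)"
  have "\<exists>r. 0 < r \<and> y ^ r * a = a * y ^ r"
    using ex_power_eq_1[OF fin y(1)] by force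
  then have r: "0 < r" "y ^ r * a = a * y ^ r"
    unfolding r_def using LeastI_ex[of "\<lambda>r. 0 < r \<and> y ^ r * a = a * y ^ r"] by auto
  have least: "y ^ i * a \<noteq> a * y ^ i" if "0 < i" "i < r" for i
    using that not_less_Least[of i "\<lambda>r. 0 < r \<and> y ^ r * a = a * y ^ r"] unfolding r_def by blast
  have "r \<noteq> 1"
    using r y by auto
  \<comment> \<open>The double centralizer \<open>K\<close> of the commuting set \<open>S\<close> is
    a commutative division ring containing \<open>S\<close>: from \<open>S \<subseteq> C\<close>
    follows \<open>K \<subseteq> C\<close>. Putting \<open>y ^ r\<close> into \<open>S\<close>
    secures \<open>y ^ r \<in> K\<close>.\<close>
  define S where "S = {a, y ^ r}"
  define C where "C = centralizer S"
  define K where "K = centralizer C"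
  have SC: "S \<subseteq> C"
    using r by (auto simp: S_def C_def centralizer_def)
  have SK: "S \<subseteq> K"
    by (auto simp: K_def C_def centralizer_def)
  have KC: "K \<subseteq> C"
    using SC by (auto simp: K_def C_def centralizer_def)
  have ypow: "y * a ^ i = (a ^ j) ^ i * y" for i
  proof (induction i)
    case (Suc i)
    have "y * a ^ Suc i = (y * a) * a ^ i"
      by (simp add: mult.assoc)
    also have "\<dots> = a ^ j * (y * a ^ i)"
      by (simp add: y mult.assoc)
    finally show ?case
      by (simp add: Suc mult.assoc)
  qed simp
  have ypows: "y ^ m * a = a ^ (j ^ m) * y ^ m" for m
  proof (induction m)
    case (Suc m)
    have "y ^ Suc m * a = y * a ^ (j ^ m) * y ^ m"
      by (simp add: Suc mult.assoc)
    then show ?case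
      by (simp add: ypow mult.assoc flip: power_mult)
  qed simp
  \<comment> \<open>The power \<open>a ^ j\<close> generates the same group as \<open>a\<close>, so conjugation by \<open>y\<close> preserves \<open>C\<close>.\<close>
  have aj: "(a ^ j) ^ (j ^ (r - 1)) = a"
  proof -
    have "a * y ^ r = a ^ (j ^ r) * y ^ r"
      using ypows[of r] r by simp
    then have "a = a ^ (j ^ r)"
      using y(1) by simp
    then show ?thesis
      using r(1) by (metis power_mult power_eq_if not_gr_zero)
  qed
  have yC: "y * x * inverse y \<in> C" if "x \<in> C" for x
  proof -
    have "y * x * inverse y \<in> centralizer {a ^ j, y ^ r}"
    proof (rule centralizer_conj[OF y(1)])
      show "x \<in> centralizer S"
        using that C_def by simp
      have "inverse y * (a ^ j * y) = a"
        using y by (simp flip: y(2) mult.assoc)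
      moreover have "inverse y * (y ^ r * y) = y ^ r"
        using y(1) by (simp add: power_commutes flip: mult.assoc)
      ultimately show "\<And>u. u \<in> {a ^ j, y ^ r} \<Longrightarrow> inverse y * u * y \<in> S"
        by (auto simp: S_def mult.assoc)
    qed
    then have *: "y * x * inverse y * a ^ j = a ^ j * (y * x * inverse y)"
      "y * x * inverse y * y ^ r = y ^ r * (y * x * inverse y)"
      by (auto simp: centralizer_def)
    have "y * x * inverse y * (a ^ j) ^ k = (a ^ j) ^ k * (y * x * inverse y)" for k
      using *(1) by (metis power_commuting_commutes)
    from this[of "j ^ (r - 1)"] have "y * x * inverse y * a = a * (y * x * inverse y)"
      unfolding aj .
    with *(2) show ?thesis
      by (simp add: C_def S_def centralizer_def)
  qed
  \<comment> \<open>This direction gives the stability of \<open>K\<close>: the element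
    \<open>y * c * inverse y\<close> commutes with \<open>C\<close> as soon as \<open>c\<close>
    commutes with the conjugates \<open>inverse y * u * y\<close> of elements \<open>u\<close> of
    \<open>C\<close>.\<close>
  have yC': "inverse y * x * y \<in> C" if "x \<in> C" for x
  proof -
    have "inverse y * x * inverse (inverse y) \<in> centralizer S"
    proof (rule centralizer_conj)
      show "x \<in> centralizer {a ^ j, y ^ r}"
        using that power_commuting_commutes[of a x j] by (simp add: C_def S_def centralizer_def)
      fix u assume "u \<in> S"
      moreover have "y * a * inverse y = a ^ j"
        using y by (simp add: mult.assoc)
      moreover have "y * y ^ r * inverse y = y ^ r"
        using y(1) by (simp add: mult.assoc flip: power_commutes)
      ultimately show "inverse (inverse y) * u * inverse y \<in> {a ^ j, y ^ r}"
        by (auto simp: S_def)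
    qed (use y in simp)
    then show ?thesis
      by (simp add: C_def)
  qed
  interpret cyclic_algebra K y a r
  proof
    show "finite K"
      by (rule finite_subset[OF subset_UNIV fin])
    show "0 \<in> K" "1 \<in> K"
      by (simp_all add: K_def centralizer_def)
    show "c + g \<in> K" if "c \<in> K" "g \<in> K" for c g
      using that by (simp add: K_def centralizer_def distrib_left distrib_right)
    show "c * g \<in> K" if "c \<in> K" "g \<in> K" for c g
    proof -
      have "c * g * u = u * (c * g)" if "u \<in> C" for u
      proof -
        have "c * u = u * c" "g * u = u * g"
          using \<open>c \<in> K\<close> \<open>g \<in> K\<close> that by (simp_all add: K_def centralizer_def)
        then show ?thesis
          by (metis mult.assoc)
      qed
      then show ?thesis
        by (simp add: K_def centralizer_def)
    qed
    show "inverse c \<in> K" if "c \<in> K" for c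
      using that centralizer_inverse by (simp add: K_def)
    show "c * g = g * c" if "c \<in> K" "g \<in> K" for c g
      using that KC by (auto simp: K_def centralizer_def)
    show "y * c * inverse y \<in> K" if "c \<in> K" for c
      using that yC' y(1) centralizer_conj[of y c C C] by (simp add: K_def)
    show "y \<noteq> 0" "1 < r"
      using y r \<open>r \<noteq> 1\<close> by simp_all
    show "a \<in> K" "y ^ r \<in> K"
      using SK by (simp_all add: S_def)
    show "y ^ i * a \<noteq> a * y ^ i" if "0 < i" "i < r" for i
      using least that .
  qed
  show False
    by (rule contradiction)
qed

subsection \<open>Central elements\<close>

text \<open>For \<open>b\<close> outside \<open>A\<close>, conjugate \<open>a\<close> by
  \<open>b\<close> and by \<open>b + 1\<close>. The two conjugates \<open>u\<close> and
  \<open>v\<close> satisfy \<open>(u - v) * b = v - a\<close>; unless \<open>u = v\<close>, this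
  puts \<open>b\<close> into \<open>A\<close>. An element of \<open>A\<close> is the difference of
  two elements outside.\<close>

lemma cartan_brauer_hua:
  fixes A :: "'a::division_ring set"
  assumes one: "1 \<in> A"
    and plus: "\<And>x z. x \<in> A \<Longrightarrow> z \<in> A \<Longrightarrow> x + z \<in> A"
    and minus: "\<And>x z. x \<in> A \<Longrightarrow> z \<in> A \<Longrightarrow> x - z \<in> A"
    and times: "\<And>x z. x \<in> A \<Longrightarrow> z \<in> A \<Longrightarrow> x * z \<in> A"
    and inv: "\<And>x. x \<in> A \<Longrightarrow> inverse x \<in> A"
    and conj: "\<And>x v. x \<in> A \<Longrightarrow> v \<noteq> 0 \<Longrightarrow> v * x * inverse v \<in> A"
    and proper: "A \<noteq> UNIV" and a: "a \<in> A"
  shows "a * b = b * a"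
proof -
  have outside: "a * b = b * a" if b: "b \<notin> A" for b
  proof -
    have b0: "b \<noteq> 0" "b + 1 \<noteq> 0"
      using b minus[OF one one] minus[OF minus[OF one one] one]
      by (auto simp: add_eq_0_iff2)
    define u v where "u = b * a * inverse b" and "v = (b + 1) * a * inverse (b + 1)"
    have uv: "u \<in> A" "v \<in> A"
      unfolding u_def v_def using conj a b0 by blast+
    have u: "u * b = b * a"
      using b0 by (simp add: u_def mult.assoc)
    have v: "v * (b + 1) = (b + 1) * a"
      using b0 by (simp add: v_def mult.assoc)
    have eq: "(u - v) * b = v - a"
      using u v by (simp add: algebra_simps)
    have "u = v"
    proof (rule ccontr)
      assume "u \<noteq> v"
      then have "b = inverse (u - v) * (v - a)"
        by (simp flip: eq mult.assoc)
      then show False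
        using b uv a times inv minus by simp
    qed
    then show ?thesis
      using eq u by simp
  qed
  show ?thesis
  proof (cases "b \<in> A")
    case True
    obtain d where d: "d \<notin> A"
      using proper by blast
    have "b + d \<notin> A"
      using minus[of "b + d" b] True d by auto
    then show ?thesis
      using outside[of "b + d"] outside[OF d] by (simp add: algebra_simps)
  qed (use outside in blast)
qed

text \<open>Compare the central elements \<open>c - u c u\<^sup>-\<^sup>1\<close> for \<open>u\<close> and \<open>u + 1\<close>.\<close>

lemma commute_of_diff_conj_central:
  fixes c :: "'a::division_ring"
  assumes central: "\<And>u x. u \<noteq> 0 \<Longrightarrow> (c - u * c * inverse u) * x = x * (c - u * c * inverse u)"
  shows "c * u = u * c"
proof (rule ccontr)
  assume nc: "c * u \<noteq> u * c"
  have u0: "u \<noteq> 0" "u + 1 \<noteq> 0"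
    using nc by (auto simp: add_eq_0_iff2)
  define z where "z u = c - u * c * inverse u" for u
  have z: "z u * u = c * u - u * c" if "u \<noteq> 0" for u
    using that by (simp add: z_def left_diff_distrib mult.assoc)
  have zc: "z u * x = x * z u" "z (u + 1) * x = x * z (u + 1)" for x
    using central u0 by (simp_all add: z_def)
  have eq: "(z u - z (u + 1)) * u = z (u + 1)"
  proof -
    have "c * (u + 1) - (u + 1) * c = c * u - u * c"
      by (simp add: algebra_simps)
    then have "z (u + 1) * (u + 1) = z u * u"
      using z u0 by simp
    then show ?thesis
      by (simp add: algebra_simps)
  qed
  have "z u \<noteq> z (u + 1)"
    using eq z[OF u0(1)] nc by auto
  then have "z u - z (u + 1) \<noteq> 0"
    by simp
  moreover have "(z u - z (u + 1)) * (c * u) = (z u - z (u + 1)) * (u * c)"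
  proof -
    have "(z u - z (u + 1)) * c = c * (z u - z (u + 1))"
      by (simp add: left_diff_distrib right_diff_distrib zc)
    then have "(z u - z (u + 1)) * (c * u) = c * ((z u - z (u + 1)) * u)"
      by (metis mult.assoc)
    also have "\<dots> = (z u - z (u + 1)) * u * c"
      by (simp only: eq zc)
    finally show ?thesis
      by (simp only: mult.assoc)
  qed
  ultimately show False
    using nc by simp
qed

lemma commute_of_frobenius_central:
  fixes a b :: "'a::division_ring"
  assumes n: "0 < n" and binomial: "\<And>i. 0 < i \<Longrightarrow> i < n \<Longrightarrow> of_nat (n choose i) = (0::'a)"
    and central: "\<And>x z :: 'a. x ^ n * z = z * x ^ n"
  shows "a * b = b * a"
proof (rule ccontr)
  assume nc: "a * b \<noteq> b * a"
  have frob: "(1 + c) ^ n = 1 + c ^ n" for c :: 'a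
    using one_plus_power_eq binomial n by blast
  define D where "D x = a * x - x * a" for x
  \<comment> \<open>For even \<open>n\<close> this also holds: the additivity at -1 then forces
    characteristic 2.\<close>
  have "(- 1) ^ n = (- 1 :: 'a)"
    using frob[of "- 1"] n by (simp add: zero_power eq_neg_iff_add_eq_0 add.commute)
  then have neg: "(- a) ^ n = - (a ^ n)"
    by (subst power_minus) simp
  \<comment> \<open>Only the two end terms survive, leaving the commutator of the central
    \<open>a ^ n\<close> with \<open>b\<close>.\<close>
  have "(D ^^ n) b = (\<Sum>i\<le>n. of_nat (n choose i) * (a ^ i * (b * (- a) ^ (n - i))))"
    using ad_funpow[where n = n and a = a and v = b] by (simp add: D_def[abs_def])
  also have "\<dots> = (\<Sum>i\<in>{0, n}. of_nat (n choose i) * (a ^ i * (b * (- a) ^ (n - i))))"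
    by (rule sum.mono_neutral_right) (use binomial in auto)
  also have "\<dots> = 0"
    using n central[of a b] by (simp add: neg)
  finally have Dn: "(D ^^ n) b = 0" .
  define m where "m = (LEAST m. (D ^^ m) b = 0)"
  have m: "(D ^^ m) b = 0"
    unfolding m_def by (rule LeastI[of _ n]) (rule Dn)
  have least: "(D ^^ i) b \<noteq> 0" if "i < m" for i
    using that not_less_Least unfolding m_def by blast
  have "m \<noteq> 0" "m \<noteq> 1"
    using m nc by (metis D_def funpow_0 mult_zero_left mult_zero_right, metis D_def One_nat_def
        funpow.simps(1,2) comp_apply id_apply eq_iff_diff_eq_0)
  then obtain k where k: "m = Suc (Suc k)"
    by (metis One_nat_def not0_implies_Suc)
  \<comment> \<open>These are the last two iterates before \<open>(D ^^ m) b = 0\<close> with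
    \<open>w\<close> nonzero, so \<open>w\<close> commutes with \<open>a\<close> while
    \<open>y\<close> does not.\<close>
  define y w where "y = (D ^^ k) b" and "w = D y"
  have w0: "w \<noteq> 0"
    using least[of "Suc k"] k by (simp add: w_def y_def)
  have "D w = 0"
    using m k by (simp add: w_def y_def)
  then have aw: "a * w = w * a"
    by (simp add: D_def)
  have iaw: "a * inverse w = inverse w * a"
    using centralizer_inverse[of w "{a}"] aw by (simp add: centralizer_def)
  \<comment> \<open>The derivation \<open>D\<close> kills \<open>inverse w\<close> and
    \<open>a\<close>, so \<open>D c = D y * inverse w * a = a\<close>.\<close>
  define c where "c = y * inverse w * a"
  have "a * c - c * a = (a * y - y * a) * inverse w * a"
    by (simp add: c_def left_diff_distrib mult.assoc) (metis mult.assoc iaw)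
  also have "\<dots> = a"
    using w0 by (simp flip: D_def w_def)
  finally have ac: "(1 + c) * a = a * c"
    by (simp add: algebra_simps)
  have "(1 + c) ^ i * a = a * c ^ i" for i
  proof (induction i)
    case (Suc i)
    have "(1 + c) ^ Suc i * a = (1 + c) * a * c ^ i"
      using Suc by (simp only: power_Suc mult.assoc)
    then show ?case
      by (simp only: ac power_Suc mult.assoc)
  qed simp
  then have "(1 + c) ^ n * a = c ^ n * a"
    using central[of c a] by simp
  then show False
    using nc frob[of c] by auto
qed

text \<open>A linear functional taking \<open>w i\<close> to 1 turns the identity into a scalar
  polynomial with infinitely many roots.\<close>

lemma coefficients_zero:
  fixes scale :: "'f::field \<Rightarrow> 'b::ab_group_add \<Rightarrow> 'b"
  assumes "vector_space scale" and "infinite (UNIV :: 'f set)"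
    and zero: "\<And>l. (\<Sum>i\<le>n. scale (l ^ i) (w i)) = 0" and "i \<le> n"
  shows "w i = 0"
proof (rule ccontr)
  assume "w i \<noteq> 0"
  interpret vector_space scale
    by fact
  interpret vector_space_pair scale "(*) :: 'f \<Rightarrow> 'f \<Rightarrow> 'f"
    by unfold_locales (simp_all add: algebra_simps)
  have "independent {w i}"
    using \<open>w i \<noteq> 0\<close> by simp
  then obtain f where f: "Vector_Spaces.linear scale (*) f" "f (w i) = 1"
    using linear_independent_extend[of "{w i}" "\<lambda>_. 1"] by auto
  define q where "q = (\<Sum>i\<le>n. monom (f (w i)) i)"
  have "poly q l = f (\<Sum>i\<le>n. scale (l ^ i) (w i))" for l
    by (simp add: q_def poly_sum poly_monom linear_sum[OF f(1)] linear_scale[OF f(1)] mult.commute)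
  then have "poly q l = 0" for l
    by (simp add: zero linear_0[OF f(1)])
  then have "q = 0"
    using poly_roots_finite[of q] assms(2) by auto
  moreover have "coeff q i = f (w i)"
    using \<open>i \<le> n\<close> by (simp add: q_def coeff_sum)
  ultimately show False
    using f by simp
qed

lemma scale_mult:
  assumes "is_algebra scale"
  shows "scale c x * y = scale c (x * y)" "x * scale c y = scale c (x * y)"
  using assms unfolding is_algebra_def by metis+

lemma scale_power:
  assumes "is_algebra scale"
  shows "scale c x ^ i = scale (c ^ i) (x ^ i)"
proof -
  interpret vector_space scale
    using assms by (simp add: is_algebra_def)
  show ?thesis
    by (induction i) (simp_all add: scale_mult[OF assms] mult.commute)
qed

lemma commute_of_power_central:
  fixes scale :: "'f::field \<Rightarrow> 'r::division_ring \<Rightarrow> 'r"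
  assumes alg: "is_algebra scale" and inf: "infinite (UNIV :: 'f set)"
    and n: "0 < n" and central: "\<And>x z :: 'r. x ^ n * z = z * x ^ n"
  shows "a * b = b * (a :: 'r)"
proof -
  interpret vector_space scale
    using alg by (simp add: is_algebra_def)
  define P where "P n \<longleftrightarrow> 0 < n \<and> (\<forall>x z :: 'r. x ^ n * z = z * x ^ n)" for n :: nat
  define m where "m = (LEAST n. P n)"
  have "P n"
    using n central by (simp add: P_def)
  then have m: "P m"
    unfolding m_def by (rule LeastI)
  have least: "\<not> P i" if "i < m" for i
    using that not_less_Least unfolding m_def by blast
  have binomial: "of_nat (m choose i) = (0::'r)" if i: "0 < i" "i < m" for i
  proof -
    \<comment> \<open>Minimality of \<open>m\<close> supplies a noncentral \<open>x ^ i\<close>.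
      Below, \<open>w k\<close> is the coefficient of \<open>l ^ k\<close> in the commutator of
      \<open>(1 + l x) ^ m\<close> with \<open>z\<close>.\<close>
    obtain x z :: 'r where xz: "x ^ i * z \<noteq> z * x ^ i"
      using least[OF i(2)] i(1) by (auto simp: P_def)
    define w where "w k = of_nat (m choose k) * (x ^ k * z - z * x ^ k)" for k
    have "(\<Sum>k\<le>m. scale (l ^ k) (w k)) = 0" for l
    proof -
      have "scale (l ^ k) (w k) = of_nat (m choose k) * scale l x ^ k * z
          - z * (of_nat (m choose k) * scale l x ^ k)" for k
      proof -
        have "z * (of_nat (m choose k) * x ^ k) = of_nat (m choose k) * (z * x ^ k)"
          by (metis mult.assoc mult_of_nat_commute)
        then show ?thesis
          by (simp add: w_def scale_power[OF alg] scale_mult[OF alg] right_diff_distrib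
              scale_right_diff_distrib mult.assoc)
      qed
      then have "(\<Sum>k\<le>m. scale (l ^ k) (w k)) = (1 + scale l x) ^ m * z - z * (1 + scale l x) ^ m"
        by (simp add: binomial_one_plus sum_distrib_left sum_distrib_right sum_subtractf)
      then show ?thesis
        using m by (simp add: P_def)
    qed
    then have "w i = 0"
      using coefficients_zero[OF vector_space_axioms inf, where w = w and n = m and i = i] i by simp
    then show ?thesis
      using xz by (simp add: w_def)
  qed
  show ?thesis
    using commute_of_frobenius_central[of m a b] m binomial unfolding P_def by blast
qed

lemma commute_of_poly_central:
  fixes scale :: "'f::field \<Rightarrow> 'r::division_ring \<Rightarrow> 'r"
  assumes alg: "is_algebra scale" and inf: "infinite (UNIV :: 'f set)"
    and deg: "degree p > 0"
    and central: "\<And>x z. poly_alg scale p x * z = z * poly_alg scale p x"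
  shows "a * b = b * (a :: 'r)"
proof (rule commute_of_power_central[OF alg inf deg])
  fix x z :: 'r
  interpret vector_space scale
    using alg by (simp add: is_algebra_def)
  \<comment> \<open>The coefficient of \<open>l ^ i\<close> in the commutator of
    \<open>p (l x)\<close> with \<open>z\<close>; the top one carries the nonzero leading
    coefficient of \<open>p\<close>.\<close>
  define w where "w i = scale (coeff p i) (x ^ i * z - z * x ^ i)" for i
  have "(\<Sum>i\<le>degree p. scale (l ^ i) (w i)) = 0" for l
  proof -
    have "scale (l ^ i) (w i)
        = scale (coeff p i) (scale l x ^ i) * z - z * scale (coeff p i) (scale l x ^ i)" for i
      by (simp add: w_def scale_power[OF alg] scale_mult[OF alg] scale_right_diff_distrib mult.commute)
    then have "(\<Sum>i\<le>degree p. scale (l ^ i) (w i))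
        = poly_alg scale p (scale l x) * z - z * poly_alg scale p (scale l x)"
      by (simp add: poly_alg_def sum_distrib_left sum_distrib_right sum_subtractf)
    then show ?thesis
      by (simp add: central)
  qed
  then have "w (degree p) = 0"
    using coefficients_zero[OF vector_space_axioms inf, where w = w and n = "degree p"] by simp
  then show "x ^ degree p * z = z * x ^ degree p"
    using deg by (auto simp: w_def)
qed

subsection \<open>Generated subalgebras\<close>

lemma finite_of_finite_scalars:
  fixes scale :: "'f::field \<Rightarrow> 'r::ring_1 \<Rightarrow> 'r"
  assumes "is_algebra scale" and "fin_dim scale" and "finite (UNIV :: 'f set)"
  shows "finite (UNIV :: 'r set)"
proof -
  interpret vector_space scale
    using assms by (simp add: is_algebra_def)
  obtain B where B: "finite B" "span B = UNIV"
    using assms by (auto simp: fin_dim_def)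
  \<comment> \<open>Coefficient functions matter only on \<open>B\<close>, and the extensional ones
    there are finite in number.\<close>
  have "range (\<lambda>u. \<Sum>v\<in>B. scale (u v) v) \<subseteq> (\<lambda>u. \<Sum>v\<in>B. scale (u v) v) ` (B \<rightarrow>\<^sub>E UNIV)"
  proof (rule image_subsetI)
    fix u :: "'r \<Rightarrow> 'f"
    have "(\<Sum>v\<in>B. scale (u v) v) = (\<Sum>v\<in>B. scale (restrict u B v) v)"
      by (rule sum.cong) auto
    then show "(\<Sum>v\<in>B. scale (u v) v) \<in> (\<lambda>u. \<Sum>v\<in>B. scale (u v) v) ` (B \<rightarrow>\<^sub>E UNIV)"
      by (rule image_eqI[where x = "restrict u B"]) auto
  qed
  moreover have "finite (B \<rightarrow>\<^sub>E (UNIV :: 'f set))"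
    using B assms(3) by (intro finite_PiE) auto
  ultimately show ?thesis
    unfolding B(2)[symmetric] span_finite[OF B(1)] by (rule finite_surj[rotated])
qed

lemma subalgebra_minus:
  assumes "is_algebra scale" and "is_subalgebra scale A" and "x \<in> A" "z \<in> A"
  shows "x - z \<in> A"
proof -
  interpret vector_space scale
    using assms by (simp add: is_algebra_def)
  have "x + scale (- 1) z \<in> A"
    using assms(2-) unfolding is_subalgebra_def by blast
  then show ?thesis
    by (simp add: scale_minus_left)
qed

text \<open>Left multiplication by \<open>x\<close> is injective on the finite-dimensional space \<open>A\<close>, hence onto.\<close>

lemma subalgebra_inverse:
  fixes scale :: "'f::field \<Rightarrow> 'r::division_ring \<Rightarrow> 'r"
  assumes alg: "is_algebra scale" and fd: "fin_dim scale" and A: "is_subalgebra scale A"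
    and x: "x \<in> A"
  shows "inverse x \<in> A"
proof (cases "x = 0")
  case False
  interpret vector_space scale
    using alg by (simp add: is_algebra_def)
  obtain B where B: "finite B" "span B = UNIV"
    using fd by (auto simp: fin_dim_def)
  obtain C where C: "C \<subseteq> B" "independent C" "B \<subseteq> span C"
    using maximal_independent_subset by blast
  have "span C = UNIV"
    using C(3) B(2) span_minimal subspace_span by blast
  then interpret finite_dimensional_vector_space scale C
    using C B finite_subset by unfold_locales auto
  interpret finite_dimensional_vector_space_pair_1 scale C scale ..
  have A_sub: "subspace A"
    using A subalgebra_minus[OF alg A x x] by (intro subspaceI) (auto simp: is_subalgebra_def)
  have lin: "Vector_Spaces.linear scale scale ((*) x)"
    by unfold_locales (simp_all add: distrib_left scale_mult[OF alg])
  have "(*) x ` A = A"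
  proof (rule subspace_dim_equal)
    show "subspace ((*) x ` A)"
      using lin A_sub by (rule linear_subspace_image)
    show "(*) x ` A \<subseteq> A"
      using A x by (auto simp: is_subalgebra_def)
    show "dim A \<le> dim ((*) x ` A)"
      using dim_image_eq[OF lin, of A] False by (simp add: inj_on_def)
  qed (rule A_sub)
  moreover have "1 \<in> A"
    using A by (simp add: is_subalgebra_def)
  ultimately obtain z where z: "z \<in> A" "1 = x * z"
    by (metis imageE)
  then have "inverse x = z"
    using inverse_unique by metis
  then show ?thesis
    using z by simp
qed (use x in simp)

lemma alg_generated_minimal:
  "is_subalgebra scale A \<Longrightarrow> S \<subseteq> A \<Longrightarrow> alg_generated scale S \<subseteq> A"
  by (auto simp: alg_generated_def)

lemma alg_generated_superset: "S \<subseteq> alg_generated scale S"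
  by (auto simp: alg_generated_def)

lemma is_subalgebra_alg_generated: "is_subalgebra scale (alg_generated scale S)"
  unfolding alg_generated_def is_subalgebra_def by blast

lemma conj_mult:
  fixes v :: "'a::division_ring"
  assumes "v \<noteq> 0"
  shows "v * (x * z) * inverse v = (v * x * inverse v) * (v * z * inverse v)"
proof -
  have "(v * x * inverse v) * (v * z * inverse v) = v * x * (inverse v * v) * z * inverse v"
    by (simp only: mult.assoc)
  also have "\<dots> = v * (x * z) * inverse v"
    unfolding left_inverse[OF assms] by (simp add: mult.assoc)
  finally show ?thesis ..
qed

text \<open>The elements whose conjugate by \<open>v\<close> lies in the generated algebra form a
  subalgebra containing \<open>S\<close>.\<close>

lemma alg_generated_conj:
  fixes scale :: "'f::field \<Rightarrow> 'r::division_ring \<Rightarrow> 'r"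
  assumes alg: "is_algebra scale"
    and S: "\<And>x v. x \<in> S \<Longrightarrow> v \<noteq> 0 \<Longrightarrow> v * x * inverse v \<in> S"
    and x: "x \<in> alg_generated scale S" and v: "v \<noteq> 0"
  shows "v * x * inverse v \<in> alg_generated scale S"
proof -
  let ?A = "alg_generated scale S" and ?c = "\<lambda>x. v * x * inverse v"
  have "is_subalgebra scale {x. ?c x \<in> ?A}"
    using is_subalgebra_alg_generated[of scale S] v
    unfolding is_subalgebra_def
    by (simp add: conj_mult[OF v] scale_mult[OF alg] distrib_left distrib_right)
  moreover have "S \<subseteq> {x. ?c x \<in> ?A}"
    using S[OF _ v] alg_generated_superset by blast
  ultimately show ?thesis
    using alg_generated_minimal x by blast
qed

lemma poly_alg_conj:
  fixes scale :: "'f::field \<Rightarrow> 'r::division_ring \<Rightarrow> 'r"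
  assumes alg: "is_algebra scale" and v: "v \<noteq> 0"
  shows "poly_alg scale p (v * x * inverse v) = v * poly_alg scale p x * inverse v"
proof -
  have "(v * x * inverse v) ^ i = v * x ^ i * inverse v" for i
  proof (induction i)
    case (Suc i)
    have "(v * x * inverse v) ^ Suc i = v * x * (inverse v * v) * x ^ i * inverse v"
      using Suc by (simp only: power_Suc mult.assoc)
    then show ?case
      using v by (simp add: mult.assoc)
  qed (use v in simp)
  then show ?thesis
    by (simp add: poly_alg_def sum_distrib_left sum_distrib_right scale_mult[OF alg])
qed

theorem theorem2p3:
  fixes scale :: "'f::field \<Rightarrow> 'r::division_ring \<Rightarrow> 'r"
    and p :: "'f poly"
  assumes "is_algebra scale"
    and "fin_dim scale"
    and "\<exists>a b :: 'r. a * b \<noteq> b * a"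
    and "degree p > 0"
  shows "alg_generated scale {poly_alg scale p (a * b) - poly_alg scale p (b * a) | a b. True} = UNIV"
proof (rule ccontr)
  let ?f = "poly_alg scale p"
  let ?S = "{?f (a * b) - ?f (b * a) | a b. True}"
  let ?A = "alg_generated scale ?S"
  assume proper: "?A \<noteq> UNIV"
  have inf: "infinite (UNIV :: 'f set)"
    using finite_of_finite_scalars[OF assms(1,2)] wedderburn_little assms(3) by blast
  have S_conj: "v * x * inverse v \<in> ?S" if "x \<in> ?S" "v \<noteq> 0" for x v
  proof -
    obtain a b where x: "x = ?f (a * b) - ?f (b * a)"
      using \<open>x \<in> ?S\<close> by blast
    let ?c = "\<lambda>x. v * x * inverse v"
    have "?c x = ?c (?f (a * b)) - ?c (?f (b * a))"
      by (simp add: x left_diff_distrib right_diff_distrib)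
    also have "\<dots> = ?f (?c a * ?c b) - ?f (?c b * ?c a)"
      by (simp only: poly_alg_conj[OF assms(1) \<open>v \<noteq> 0\<close>, symmetric] conj_mult[OF \<open>v \<noteq> 0\<close>])
    finally show ?thesis
      by blast
  qed
  note A = is_subalgebra_alg_generated[of scale ?S]
  have A_central: "x * z = z * x" if "x \<in> ?A" for x z
  proof (rule cartan_brauer_hua[of ?A])
    show "1 \<in> ?A" "\<And>x z. x \<in> ?A \<Longrightarrow> z \<in> ?A \<Longrightarrow> x + z \<in> ?A"
      "\<And>x z. x \<in> ?A \<Longrightarrow> z \<in> ?A \<Longrightarrow> x * z \<in> ?A"
      using A unfolding is_subalgebra_def by blast+
    show "v * x * inverse v \<in> ?A" if "x \<in> ?A" "v \<noteq> 0" for x v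
      using alg_generated_conj[OF assms(1) S_conj that] by blast
  qed (fact subalgebra_minus[OF assms(1) A] subalgebra_inverse[OF assms(1,2) A] proper that)+
  have "?f x * u = u * ?f x" for x u
  proof (rule commute_of_diff_conj_central)
    fix u z :: 'r
    assume "u \<noteq> 0"
    \<comment> \<open>Take the factors \<open>x * inverse u\<close> and \<open>u\<close>: their
      product is \<open>x\<close>, and in the other order it is the conjugate of \<open>x\<close> by
      \<open>u\<close>.\<close>
    then have "?f x - u * ?f x * inverse u = ?f (x * inverse u * u) - ?f (u * (x * inverse u))"
      using poly_alg_conj[OF assms(1), of u p x] by (simp add: mult.assoc)
    also have "\<dots> \<in> ?A"
      by (rule subsetD[OF alg_generated_superset]) blast
    finally show "(?f x - u * ?f x * inverse u) * z = z * (?f x - u * ?f x * inverse u)"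
      by (rule A_central)
  qed
  then show False
    using commute_of_poly_central[OF assms(1) inf assms(4)] assms(3) by blast
qed

end
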